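(* For every $\mathbf{k}=(k_1,\ldots,k_r;k_\infty)$ with $r\ge0$ and $k_1,\ldots,k_r,k_\infty\in\mathbb{N}$, $$\mathrm{Li}^-_{k_1}\cdots\mathrm{Li}^-_{k_r}\,\mathrm{Li}^-_{k_\infty}=\mathrm{Li}^-_{\pi(M^{(\mathbf{k})}x_1)} .$$
   Context: $\mathbb{N}$ is the set of non-negative integers. For $\mathbf{s}=(s_1,\ldots,s_r)\in\mathbb{N}^r$ put $\mathrm{Li}^-_{\mathbf{s}}(z):=\sum_{n_1>\cdots>n_r>0}n_1^{s_1}\cdots n_r^{s_r}z^{n_1}$ for $|z|<1$ (empty index gives $1$); each is a rational function in $\mathbb{C}[z,(1-z)^{-1}]$, and products are products of these functions; $\mathrm{Li}^-_k$ denotes the depth-one function $\mathrm{Li}^-_{(k)}$. Let $\mathbb{C}\langle Y\rangle$ be the free associative $\mathbb{C}$-algebra on $Y=\{y_0,y_1,\ldots\}$, and let $\mathrm{Li}^-_\bullet:\mathbb{C}\langle Y\rangle\to\mathbb{C}[z,(1-z)^{-1}]$ be the $\mathbb{C}$-linear map sending the word $y_{s_1}\cdots y_{s_r}$ to $\mathrm{Li}^-_{(s_1,\ldots,s_r)}$ (empty word to $1$). Let $\mathbb{C}\langle x_0,x_1\rangle$ be the free associative algebra on $x_0,x_1$, and $\pi:\mathbb{C}\langle x_0,x_1\rangle x_1\to\mathbb{C}\langle Y\rangle$ the $\mathbb{C}$-linear isomorphism from the span of words ending in $x_1$ given by $x_0^{s_1}x_1x_0^{s_2}x_1\cdots x_0^{s_r}x_1\mapsto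 y_{s_1}y_{s_2}\cdots y_{s_r}$. Define $x_1^{(0)}:=x_1$, $x_1^{(m)}:=x_0x_1^{(m-1)}-x_1^{(m-1)}x_0$ for $m>0$, and the Magnus polynomial $M^{(k_1,\ldots,k_r;k_\infty)}:=x_1^{(k_1)}\cdots x_1^{(k_r)}x_0^{k_\infty}$. *)

theory Defs
  imports "HOL-Analysis.Analysis" "HOL-Library.Poly_Mapping"
begin

text \<open>
  Words form a monoid under concatenation. With this instance, \<open>'a list \<Rightarrow>\<^sub>0 complex\<close> with the
  convolution product of \<open>Poly_Mapping\<close> is the free associative complex algebra on \<open>'a\<close>.
\<close>

instantiation list :: (type) monoid_add
begin

definition zero_list :: "'a list" where
  "zero_list = []"

definition plus_list :: "'a list \<Rightarrow> 'a list \<Rightarrow> 'a list" where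
  "plus_list u v = u @ v"

instance
  by standard (simp_all add: zero_list_def plus_list_def)

end

type_synonym 'a free_algebra = "'a list \<Rightarrow>\<^sub>0 complex"

definition gen :: "'a \<Rightarrow> 'a free_algebra" where
  "gen a = Poly_Mapping.single [a] 1"

datatype letter = X0 | X1

abbreviation x0 :: "letter free_algebra" where
  "x0 \<equiv> gen X0"

abbreviation x1 :: "letter free_algebra" where
  "x1 \<equiv> gen X1"

text \<open>The alphabet \<open>Y\<close> is \<open>nat\<close>: the letter \<open>y\<^sub>s\<close> is represented by its index \<open>s\<close>.\<close>

definition decreasing_tuples :: "nat \<Rightarrow> nat list set" where
  "decreasing_tuples r =
     {ns. length ns = r \<and> sorted_wrt (>) ns \<and> (\<forall>n\<in>set ns. n > 0)}"

text \<open>Meaningful for \<open>norm z < 1\<close>, where the series converges absolutely.\<close>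

definition Li_neg :: "nat list \<Rightarrow> complex \<Rightarrow> complex" where
  "Li_neg s z =
     (if s = [] then 1
      else \<Sum>\<^sub>\<infinity>ns\<in>decreasing_tuples (length s).
             (\<Prod>i<length s. of_nat (ns ! i) ^ (s ! i)) * z ^ hd ns)"

definition Li_neg_lin :: "nat free_algebra \<Rightarrow> complex \<Rightarrow> complex" where
  "Li_neg_lin P z = (\<Sum>w\<in>Poly_Mapping.keys P. Poly_Mapping.lookup P w * Li_neg w z)"

text \<open>
  \<open>pi_word\<close> reads off the exponents \<open>s\<^sub>1, \<dots>, s\<^sub>r\<close> of \<open>x\<^sub>0\<^bsup>s\<^sub>1\<^esup> x\<^sub>1 \<dots> x\<^sub>0\<^bsup>s\<^sub>r\<^esup> x\<^sub>1\<close>; the first argument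
  of \<open>pi_word_aux\<close> counts the letters \<open>x\<^sub>0\<close> seen since the last \<open>x\<^sub>1\<close>. Its value on words
  ending in \<open>x\<^sub>0\<close> is irrelevant, as these lie outside the domain of \<open>\<pi>\<close>.
\<close>

fun pi_word_aux :: "nat \<Rightarrow> letter list \<Rightarrow> nat list" where
  "pi_word_aux k [] = []"
| "pi_word_aux k (X0 # w) = pi_word_aux (Suc k) w"
| "pi_word_aux k (X1 # w) = k # pi_word_aux 0 w"

definition pi_word :: "letter list \<Rightarrow> nat list" where
  "pi_word w = pi_word_aux 0 w"

definition pi_Y :: "letter free_algebra \<Rightarrow> nat free_algebra" where
  "pi_Y P = (\<Sum>w\<in>Poly_Mapping.keys P. Poly_Mapping.single (pi_word w) (Poly_Mapping.lookup P w))"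

lemma pi_word_aux_replicate:
  "pi_word_aux k (replicate n X0 @ X1 # w) = (k + n) # pi_word_aux 0 w"
  by (induction n arbitrary: k) simp_all

lemma pi_word_concat:
  "pi_word (concat (map (\<lambda>k. replicate k X0 @ [X1]) s)) = s"
  by (induction s) (simp_all add: pi_word_def pi_word_aux_replicate)

lemma pi_Y_word:
  "pi_Y (Poly_Mapping.single (concat (map (\<lambda>k. replicate k X0 @ [X1]) s)) c) =
     Poly_Mapping.single s c"
  by (simp add: pi_Y_def pi_word_concat)

fun x1_ad :: "nat \<Rightarrow> letter free_algebra" where
  "x1_ad 0 = x1"
| "x1_ad (Suc m) = x0 * x1_ad m - x1_ad m * x0"

definition magnus :: "nat list \<Rightarrow> nat \<Rightarrow> letter free_algebra" where
  "magnus ks k_inf = prod_list (map x1_ad ks) * x0 ^ k_inf"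

end

theory Submission imports Defs begin

text \<open>
  Let \<open>x\<^sub>0\<close> act on power series as the derivation \<open>D = z d/dz\<close> and \<open>x\<^sub>1\<close> as multiplication by
  \<open>L = z/(1 - z)\<close>. Applied to \<open>1\<close>, a word \<open>w\<close> ending in \<open>x\<^sub>1\<close> gives the Taylor series of the
  polylogarithm indexed by \<open>\<pi>(w)\<close>. By the Leibniz rule, the commutator of \<open>D\<close> with multiplication
  by \<open>g\<close> is multiplication by \<open>D g\<close>, so \<open>x\<^sub>1\<^bsup>(k)\<^esup>\<close> acts as multiplication by \<open>D\<^sup>k L\<close>, the series
  of depth one and index \<open>k\<close>. Hence \<open>M\<^bsup>(\<^bold>k)\<^esup> x\<^sub>1\<close> sends \<open>1\<close> to the product of the depth one series.
\<close>

text \<open>An identity additive in \<open>P\<close> thus only needs checking on scalar multiples of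
  words: updating at a fresh word amounts to adding a \<open>single\<close>.\<close>

lemma free_algebra_induct [case_names single add]:
  fixes P :: "'a free_algebra"
  assumes single: "\<And>w c. Q (Poly_Mapping.single w c)"
    and add: "\<And>R S. Q R \<Longrightarrow> Q S \<Longrightarrow> Q (R + S)"
  shows "Q P"
proof (induction P rule: update_induct)
  case const
  show ?case using single[of undefined 0] by simp
next
  case (update P w c)
  have "Poly_Mapping.update w c P = P + Poly_Mapping.single w c"
    using update(1) by (intro poly_mapping_eqI)
      (auto simp: lookup_update lookup_add lookup_single when_def in_keys_iff)
  thus ?case using add[OF update(3) single] by simp
qed

section \<open>The Euler derivation and the series of z/(1 - z)\<close>

definition Li0_fps :: "complex fps" where
  "Li0_fps = fps_X * Abs_fps (\<lambda>_. 1)"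

lemma fps_nth_XD_funpow: "fps_nth ((fps_XD ^^ k) f) n = of_nat n ^ k * fps_nth f n"
  by (induction k) (simp_all add: mult.assoc)

lemma fps_XD_mult:
  fixes f g :: "'a :: comm_semiring_1 fps"
  shows "fps_XD (f * g) = fps_XD f * g + f * fps_XD g"
  by (simp add: fps_XD_def algebra_simps)

text \<open>The geometric series produces partial sums; the extra factor \<open>fps_X\<close> makes
  the bound strict, matching the strict decrease of the summation indices.\<close>

lemma fps_nth_Li0_mult: "fps_nth (Li0_fps * f) n = (\<Sum>m<n. fps_nth f m)"
proof (cases n)
  case (Suc n')
  have "fps_nth (Li0_fps * f) n = fps_nth (fps_X * (f * Abs_fps (\<lambda>_. 1))) n"
    by (simp add: Li0_fps_def mult_ac)
  also have "\<dots> = (\<Sum>m<n. fps_nth f m)"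
    by (simp only: Suc fps_X_mult_nth)
       (simp add: fps_mult_nth atLeast0AtMost lessThan_Suc_atMost)
  finally show ?thesis .
qed (simp add: Li0_fps_def)

section \<open>The free algebra acting on power series\<close>

fun word_action :: "letter list \<Rightarrow> complex fps \<Rightarrow> complex fps" where
  "word_action [] f = f"
| "word_action (X0 # w) f = fps_XD (word_action w f)"
| "word_action (X1 # w) f = Li0_fps * word_action w f"

lemma word_action_append: "word_action (u @ v) f = word_action u (word_action v f)"
  by (induction u f rule: word_action.induct) simp_all

lemma fps_XD_cmult: "fps_XD (fps_const c * f) = fps_const c * fps_XD (f :: complex fps)"
  by (simp add: fps_XD_mult fps_XD_def)

lemma word_action_add: "word_action w (f + g) = word_action w f + word_action w g"
  by (induction w f rule: word_action.induct) (simp_all add: fps_XD_add algebra_simps)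

lemma word_action_cmult: "word_action w (fps_const c * f) = fps_const c * word_action w f"
  by (induction w f rule: word_action.induct) (simp_all add: fps_XD_cmult algebra_simps)

definition action :: "letter free_algebra \<Rightarrow> complex fps \<Rightarrow> complex fps" where
  "action P f =
     (\<Sum>w\<in>Poly_Mapping.keys P. fps_const (Poly_Mapping.lookup P w) * word_action w f)"

lemma action_single: "action (Poly_Mapping.single w c) f = fps_const c * word_action w f"
  by (simp add: action_def)

lemma action_add: "action (P + Q) f = action P f + action Q f"
  unfolding action_def
  by (rule setsum_keys_plus_distrib) (simp_all add: algebra_simps flip: fps_const_add)

lemma action_diff: "action (P - Q) f = action P f - action Q f"
  using action_add[of "P - Q" Q f] by simp

lemma action_arg_add: "action P (f + g) = action P f + action P g"
  by (simp add: action_def word_action_add algebra_simps sum.distrib)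

lemma action_arg_cmult: "action P (fps_const c * f) = fps_const c * action P f"
  by (simp add: action_def word_action_cmult sum_distrib_left mult.left_commute)

text \<open>Both sides are additive in \<open>P\<close> and in \<open>Q\<close>; on words,
  concatenation acts as composition.\<close>

lemma action_mult: "action (P * Q) f = action P (action Q f)"
proof (induction P rule: free_algebra_induct)
  case (single u a)
  show ?case
  proof (induction Q rule: free_algebra_induct)
    case (single v b)
    show ?case
      by (simp add: mult_single action_single plus_list_def word_action_append
          word_action_cmult mult_ac flip: fps_const_mult)
  next
    case (add R S)
    thus ?case by (simp add: distrib_left action_add action_arg_add)
  qed
next
  case (add R S)
  thus ?case by (simp add: distrib_right action_add)
qed

lemma action_x0: "action x0 f = fps_XD f"
  by (simp add: gen_def action_single)

lemma action_x1: "action x1 f = Li0_fps * f"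
  by (simp add: gen_def action_single)

lemma action_one: "action 1 f = f"
  by (simp add: action_single zero_list_def flip: single_one)

text \<open>In the commutator the two Leibniz terms containing \<open>fps_XD f\<close> cancel. The
  induction keeps \<open>f\<close> arbitrary because its hypothesis is applied to \<open>f\<close>
  and to \<open>fps_XD f\<close>.\<close>

lemma action_x1_ad: "action (x1_ad m) f = (fps_XD ^^ m) Li0_fps * f"
  by (induction m arbitrary: f)
     (simp_all add: action_x0 action_x1 action_diff action_mult fps_XD_mult)

lemma action_x0_power: "action (x0 ^ k) f = (fps_XD ^^ k) f"
  by (induction k) (simp_all add: action_one action_mult action_x0)

lemma action_prod_x1_ad:
  "action (prod_list (map x1_ad ks)) f = prod_list (map (\<lambda>k. (fps_XD ^^ k) Li0_fps) ks) * f"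
  by (induction ks) (simp_all add: action_one action_mult action_x1_ad mult_ac)

lemma action_magnus_x1:
  "action (magnus ks k * x1) 1 =
     prod_list (map (\<lambda>k. (fps_XD ^^ k) Li0_fps) ks) * (fps_XD ^^ k) Li0_fps"
  by (simp add: magnus_def action_mult action_prod_x1_ad action_x0_power action_x1)

text \<open>The Taylor series of \<open>Li_neg s\<close>, one letter of the alphabet Y per
  step.\<close>

fun Li_fps :: "nat list \<Rightarrow> complex fps" where
  "Li_fps [] = 1"
| "Li_fps (s # ss) = (fps_XD ^^ s) (Li0_fps * Li_fps ss)"

text \<open>The power \<open>k\<close> stands for the letters \<open>X0\<close> already counted by
  \<open>pi_word_aux\<close>. The final \<open>X1\<close> ensures that every counted letter enters
  the index.\<close>

lemma word_action_eq_Li_fps: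
  "(fps_XD ^^ k) (word_action (w @ [X1]) 1) = Li_fps (pi_word_aux k (w @ [X1]))"
proof (induction k w rule: pi_word_aux.induct)
  case (2 k w)
  thus ?case by (simp add: funpow_swap1)
qed simp_all

section \<open>Convergence in the unit disc\<close>

lemma fps_conv_radius_fps_XD_ge:
  fixes f :: "'a :: {banach, real_normed_field} fps"
  shows "1 \<le> fps_conv_radius f \<Longrightarrow> 1 \<le> fps_conv_radius (fps_XD f)"
  unfolding fps_XD_def o_apply
  using fps_conv_radius_mult[of fps_X "fps_deriv f"] fps_conv_radius_deriv[of f]
  by (auto intro: order_trans)

lemma fps_conv_radius_fps_XD_funpow_ge:
  fixes f :: "'a :: {banach, real_normed_field} fps"
  shows "1 \<le> fps_conv_radius f \<Longrightarrow> 1 \<le> fps_conv_radius ((fps_XD ^^ k) f)"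
  by (induction k) (simp_all add: fps_conv_radius_fps_XD_ge)

lemma fps_conv_radius_mult_ge:
  fixes f g :: "complex fps"
  shows "r \<le> fps_conv_radius f \<Longrightarrow> r \<le> fps_conv_radius g \<Longrightarrow> r \<le> fps_conv_radius (f * g)"
  using fps_conv_radius_mult[of f g] order_trans[OF min.boundedI] by blast

lemma fps_conv_radius_Li0_ge: "1 \<le> fps_conv_radius Li0_fps"
proof -
  have "1 \<le> fps_conv_radius (Abs_fps (\<lambda>_. 1 :: complex))"
    unfolding fps_conv_radius_def fps_nth_Abs_fps
    by (rule conv_radius_geI_ex') (auto intro!: summable_geometric)
  thus ?thesis
    unfolding Li0_fps_def by (intro fps_conv_radius_mult_ge) simp_all
qed

lemma norm_less_fps_conv_radius:
  assumes "norm z < 1" "1 \<le> fps_conv_radius f"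
  shows "ereal (norm z) < fps_conv_radius f"
  using less_le_trans[of "ereal (norm z)" 1] assms by simp

lemma fps_conv_radius_word_action_ge:
  "1 \<le> fps_conv_radius f \<Longrightarrow> 1 \<le> fps_conv_radius (word_action w f)"
  by (induction w f rule: word_action.induct)
     (simp_all add: fps_conv_radius_fps_XD_ge fps_conv_radius_mult_ge fps_conv_radius_Li0_ge)

lemma fps_conv_radius_action_ge:
  "1 \<le> fps_conv_radius f \<Longrightarrow> 1 \<le> fps_conv_radius (action P f)"
proof (induction P rule: free_algebra_induct)
  case (single w c)
  thus ?case
    by (simp add: action_single fps_conv_radius_mult_ge fps_conv_radius_word_action_ge)
next
  case (add R S)
  thus ?case
    using fps_conv_radius_add[of "action R f" "action S f"] order_trans[OF min.boundedI]
    unfolding action_add by blast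
qed

lemma fps_conv_radius_Li_fps_ge: "1 \<le> fps_conv_radius (Li_fps s)"
  by (induction s)
     (simp_all add: fps_conv_radius_fps_XD_funpow_ge fps_conv_radius_mult_ge fps_conv_radius_Li0_ge)

section \<open>Taylor coefficients as finite sums over tuples\<close>

text \<open>Fixing the largest entry \<open>n\<close> leaves a finite set, the one that contributes
  to the coefficient of z^n; \<open>r\<close> counts the entries after the head.\<close>

definition tuples_from :: "nat \<Rightarrow> nat \<Rightarrow> nat list set" where
  "tuples_from r n = {ns \<in> decreasing_tuples (Suc r). hd ns = n}"

definition tuple_weight :: "nat list \<Rightarrow> nat list \<Rightarrow> nat" where
  "tuple_weight s ns = (\<Prod>i<length s. (ns ! i) ^ (s ! i))"

lemma tuple_weight_Cons: "tuple_weight (s # ss) (n # ns) = n ^ s * tuple_weight ss ns"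
  by (simp add: tuple_weight_def prod.lessThan_Suc_shift del: prod.lessThan_Suc)

lemma finite_tuples_from: "finite (tuples_from r n)"
proof (rule finite_subset)
  show "tuples_from r n \<subseteq> {ns. set ns \<subseteq> {..n} \<and> length ns = Suc r}"
    by (auto simp: tuples_from_def decreasing_tuples_def length_Suc_conv less_imp_le)
qed (simp add: finite_lists_length_eq)

lemma tuples_from_0: "tuples_from 0 n = (if n = 0 then {} else {[n]})"
  by (auto simp: tuples_from_def decreasing_tuples_def length_Suc_conv)

lemma tuples_from_Suc: "tuples_from (Suc r) n = (#) n ` (\<Union>m<n. tuples_from r m)"
proof (intro equalityI subsetI)
  fix ns assume "ns \<in> tuples_from (Suc r) n"
  then obtain m ms where "ns = n # m # ms" "m < n" "m # ms \<in> tuples_from r m"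
    by (auto simp: tuples_from_def decreasing_tuples_def length_Suc_conv)
  thus "ns \<in> (#) n ` (\<Union>m<n. tuples_from r m)" by auto
next
  fix ns assume "ns \<in> (#) n ` (\<Union>m<n. tuples_from r m)"
  thus "ns \<in> tuples_from (Suc r) n"
    by (fastforce simp: tuples_from_def decreasing_tuples_def length_Suc_conv)
qed

text \<open>Prepending a letter takes strict partial sums and multiplies by \<open>n ^ s\<close>; on
  tuples this prepends a new head \<open>n\<close> above the old head \<open>m\<close>.\<close>

lemma fps_nth_Li_fps:
  "fps_nth (Li_fps (s # ss)) n =
     of_nat (\<Sum>ns\<in>tuples_from (length ss) n. tuple_weight (s # ss) ns)"
proof (induction ss arbitrary: s n)
  case Nil
  have "tuple_weight [s] [n] = n ^ s" by (simp add: tuple_weight_def)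
  moreover have "fps_nth Li0_fps n = (if n = 0 then 0 else 1)"
    by (simp add: Li0_fps_def)
  ultimately show ?case
    by (simp add: fps_nth_XD_funpow tuples_from_0)
next
  case (Cons t ts)
  have "(\<Sum>ns\<in>tuples_from (Suc (length ts)) n. tuple_weight (s # t # ts) ns) =
          n ^ s * (\<Sum>ns\<in>(\<Union>m<n. tuples_from (length ts) m). tuple_weight (t # ts) ns)"
    unfolding tuples_from_Suc
    by (subst sum.reindex) (simp_all add: tuple_weight_Cons sum_distrib_left)
  also have "(\<Sum>ns\<in>(\<Union>m<n. tuples_from (length ts) m). tuple_weight (t # ts) ns) =
          (\<Sum>m<n. \<Sum>ns\<in>tuples_from (length ts) m. tuple_weight (t # ts) ns)"
    \<comment> \<open>The union is disjoint because a tuple determines its head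
      \<open>m\<close>.\<close>
    by (rule sum.UNION_disjoint) (auto simp: finite_tuples_from, auto simp: tuples_from_def)
  finally have eq: "(\<Sum>ns\<in>tuples_from (Suc (length ts)) n. tuple_weight (s # t # ts) ns) =
          n ^ s * (\<Sum>m<n. \<Sum>ns\<in>tuples_from (length ts) m. tuple_weight (t # ts) ns)" .
  have "fps_nth (Li_fps (s # t # ts)) n = of_nat n ^ s * (\<Sum>m<n. fps_nth (Li_fps (t # ts)) m)"
    by (simp only: Li_fps.simps(2)[of s] fps_nth_XD_funpow fps_nth_Li0_mult)
  also have "\<dots> = of_nat (n ^ s * (\<Sum>m<n. \<Sum>ns\<in>tuples_from (length ts) m. tuple_weight (t # ts) ns))"
    by (simp only: Cons.IH of_nat_mult of_nat_power of_nat_sum)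
  finally show ?case
    by (simp only: eq list.size add_0_right add_Suc_right One_nat_def)
qed

lemma bij_betw_tuples_from:
  "bij_betw snd (Sigma UNIV (tuples_from r)) (decreasing_tuples (Suc r))"
  by (rule bij_betwI[where g = "\<lambda>ns. (hd ns, ns)"]) (auto simp: tuples_from_def)

text \<open>Grouping the tuples by their head turns the defining sum into the power series; absolute
  convergence permits the regrouping.\<close>

lemma Li_neg_eq_eval_fps:
  assumes z: "norm z < 1"
  shows "Li_neg s z = eval_fps (Li_fps s) z"
proof (cases s)
  case Nil
  thus ?thesis by (simp add: Li_neg_def)
next
  case (Cons t ts)
  define r where "r = length ts"
  define g where "g = (\<lambda>ns. of_nat (tuple_weight s ns) * z ^ hd ns)"
  have conv: "ereal (norm z) < fps_conv_radius (Li_fps s)"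
    by (rule norm_less_fps_conv_radius[OF z fps_conv_radius_Li_fps_ge])
  have inner: "(\<Sum>ns\<in>tuples_from r n. g ns) = fps_nth (Li_fps s) n * z ^ n" for n
  proof -
    have "(\<Sum>ns\<in>tuples_from r n. g ns) =
            (\<Sum>ns\<in>tuples_from r n. of_nat (tuple_weight s ns) * z ^ n)"
      by (rule sum.cong) (auto simp: g_def tuples_from_def)
    thus ?thesis
      by (simp only: Cons r_def fps_nth_Li_fps of_nat_sum sum_distrib_right)
  qed
  \<comment> \<open>The weights are natural numbers and the power of \<open>z\<close> is constant on
    each group, so the triangle inequality is an equality here.\<close>
  have inner_norm: "(\<Sum>ns\<in>tuples_from r n. norm (g ns)) = norm (fps_nth (Li_fps s) n * z ^ n)" for n
  proof -
    have "(\<Sum>ns\<in>tuples_from r n. norm (g ns)) =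
            (\<Sum>ns\<in>tuples_from r n. of_nat (tuple_weight s ns) * norm z ^ n)"
      by (rule sum.cong) (auto simp: g_def tuples_from_def norm_mult norm_power)
    also have "\<dots> = of_nat (\<Sum>ns\<in>tuples_from r n. tuple_weight s ns) * norm z ^ n"
      by (simp add: sum_distrib_right)
    finally show ?thesis
      by (simp only: Cons r_def fps_nth_Li_fps norm_mult norm_power norm_of_nat)
  qed
  have norm_summable: "summable (\<lambda>n. norm (fps_nth (Li_fps s) n * z ^ n))"
    using conv by (rule norm_summable_fps)
  \<comment> \<open>The groups are finite, so it suffices that their norm sums are summable over
    \<open>n\<close>, which is absolute convergence of the power series.\<close>
  have "(\<lambda>p. norm (g (snd p))) summable_on Sigma UNIV (tuples_from r)"
    unfolding Infinite_Sum.abs_summable_on_Sigma_iff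
    using norm_summable
    by (simp add: finite_tuples_from inner_norm norm_summable_imp_summable_on)
  hence "(\<lambda>p. g (snd p)) summable_on Sigma UNIV (tuples_from r)"
    by (rule abs_summable_summable)
  from infsum_Sigma_banach[OF this]
  have "infsum (\<lambda>p. g (snd p)) (Sigma UNIV (tuples_from r)) =
          infsum (\<lambda>n. fps_nth (Li_fps s) n * z ^ n) UNIV"
    by (simp add: finite_tuples_from inner)
  also have "\<dots> = eval_fps (Li_fps s) z"
    using norm_summable_imp_has_sum[OF norm_summable sums_eval_fps[OF conv]]
    by (rule infsumI)
  also have "infsum (\<lambda>p. g (snd p)) (Sigma UNIV (tuples_from r)) = infsum g (decreasing_tuples (Suc r))"
    by (rule infsum_reindex_bij_betw[OF bij_betw_tuples_from])
  finally show ?thesis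
    by (simp add: Li_neg_def Cons r_def g_def tuple_weight_def)
qed

section \<open>Linear extension and evaluation\<close>

lemma pi_Y_single: "pi_Y (Poly_Mapping.single w c) = Poly_Mapping.single (pi_word w) c"
  by (simp add: pi_Y_def)

lemma pi_Y_add: "pi_Y (P + Q) = pi_Y P + pi_Y Q"
  unfolding pi_Y_def by (rule setsum_keys_plus_distrib) (simp_all add: single_add)

lemma Li_neg_lin_single: "Li_neg_lin (Poly_Mapping.single s c) z = c * Li_neg s z"
  by (simp add: Li_neg_lin_def)

lemma Li_neg_lin_add: "Li_neg_lin (P + Q) z = Li_neg_lin P z + Li_neg_lin Q z"
  unfolding Li_neg_lin_def by (rule setsum_keys_plus_distrib) (simp_all add: algebra_simps)

text \<open>Both sides are additive in \<open>P\<close>, and the factor \<open>x1\<close> makes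
  every word end in \<open>X1\<close>, so \<open>word_action_eq_Li_fps\<close> applies with counter
  0.\<close>

lemma Li_neg_lin_pi_Y_mult_x1:
  assumes z: "norm z < 1"
  shows "Li_neg_lin (pi_Y (P * x1)) z = eval_fps (action (P * x1) 1) z"
proof (induction P rule: free_algebra_induct)
  case (single w c)
  have "ereal (norm z) < fps_conv_radius (Li_fps (pi_word (w @ [X1])))"
    by (rule norm_less_fps_conv_radius[OF z fps_conv_radius_Li_fps_ge])
  moreover have "word_action (w @ [X1]) 1 = Li_fps (pi_word (w @ [X1]))"
    using word_action_eq_Li_fps[of 0 w] by (simp add: pi_word_def)
  moreover have "Poly_Mapping.single w c * x1 = Poly_Mapping.single (w @ [X1]) c"
    by (simp add: gen_def mult_single plus_list_def)
  ultimately show ?case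
    by (simp add: pi_Y_single Li_neg_lin_single action_single eval_fps_mult
        Li_neg_eq_eval_fps[OF z])
next
  case (add R S)
  \<comment> \<open>Evaluation at \<open>z\<close> respects the sum because both series converge
    there.\<close>
  have "ereal (norm z) < fps_conv_radius (action Q 1)" for Q
    using z by (simp add: norm_less_fps_conv_radius fps_conv_radius_action_ge)
  thus ?case
    using add by (simp add: distrib_right pi_Y_add Li_neg_lin_add action_add eval_fps_add)
qed

theorem theorem4p8:
  fixes ks :: "nat list" and k_inf :: nat and z :: complex
  assumes "norm z < 1"
  shows "prod_list (map (\<lambda>k. Li_neg [k] z) ks) * Li_neg [k_inf] z =
           Li_neg_lin (pi_Y (magnus ks k_inf * x1)) z"
proof -
  note conv = norm_less_fps_conv_radius[OF assms]
  have radius: "1 \<le> fps_conv_radius ((fps_XD ^^ k) Li0_fps)" for k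
    by (simp add: fps_conv_radius_fps_XD_funpow_ge fps_conv_radius_Li0_ge)
  have radius_prod: "1 \<le> fps_conv_radius (prod_list (map (\<lambda>k. (fps_XD ^^ k) Li0_fps) ks))" for ks
    by (induction ks) (simp_all add: fps_conv_radius_mult_ge radius)
  have depth_one: "Li_neg [k] z = eval_fps ((fps_XD ^^ k) Li0_fps) z" for k
    by (simp add: Li_neg_eq_eval_fps[OF assms])
  \<comment> \<open>Evaluation at \<open>z\<close> is multiplicative on series with radius at least
    1, so the product can be formed before evaluating and compared with
    \<open>action_magnus_x1\<close>.\<close>
  have "prod_list (map (\<lambda>k. Li_neg [k] z) ks) =
          eval_fps (prod_list (map (\<lambda>k. (fps_XD ^^ k) Li0_fps) ks)) z"
    by (induction ks) (simp_all add: depth_one eval_fps_mult conv radius radius_prod)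
  thus ?thesis
    by (simp add: Li_neg_lin_pi_Y_mult_x1[OF assms] action_magnus_x1 depth_one eval_fps_mult
        conv radius radius_prod)
qed

end
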